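(* Let $N$ be a positive integer, $a\in\mathbb{Z}_N$, and consider the DCY model, i.e. the $\mathbf{BB}_N(f,g)$ code over $R=\mathbb{Z}_N[x^{\pm},y^{\pm}]$ with $$f=x^2-(a+1)x+a=(x-1)(x-a),\qquad g=y^2-(a+1)y+a=(y-1)(y-a).$$ Let $N_a$ be the largest divisor of $N$ coprime to $a$, let $\operatorname{ord}_{N_a}(a)$ be the smallest positive integer $\alpha$ with $a^{\alpha}\equiv1\pmod{N_a}$, and let $G_\alpha=\sum_{m=0}^{\alpha-1}a^m$. Then the anyon periodicities are $$l_x=l_y=l_{\mathrm{DCY}}=\operatorname{ord}_{N_a}(a)\,\frac{N_a}{\gcd\bigl(G_{\operatorname{ord}_{N_a}(a)},N_a\bigr)},$$ and the mobility group is $$\Lambda_{\mathrm{DCY}}=\langle x^{l_{\mathrm{DCY}}},y^{l_{\mathrm{DCY}}}\rangle\cong l_{\mathrm{DCY}}\mathbb{Z}\oplus l_{\mathrm{DCY}}\mathbb{Z}.$$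
   Context: $\mathbb{Z}_N=\mathbb{Z}/N\mathbb{Z}$; $R=\mathbb{Z}_N[x^{\pm},y^{\pm}]$ is the Laurent polynomial ring. $\Lambda=\{x^iy^j\mid i,j\in\mathbb{Z}\}\subset R^\times$ is the lattice translation group. For a code specified by $f,g\in R$ (with $(f,g)_R$ the ideal of $R$ they generate), the mobility group is $\{\lambda\in\Lambda\mid\lambda-1\in(f,g)_R\}$ (equivalently, the translations acting trivially on the anyon module $R/(f,g)\oplus R/(\bar f,\bar g)$, where $\bar h(x,y)=h(x^{-1},y^{-1})$), and the anyon periodicities are $$l_x=\min\{\alpha\in\mathbb{Z}_{>0}\mid x^{\alpha}-1\in(f,g)_R\},\qquad l_y=\min\{\beta\in\mathbb{Z}_{>0}\mid y^{\beta}-1\in(f,g)_R\}.$$ $\langle\cdot,\cdot\rangle$ denotes the generated subgroup of $\Lambda$. In gcd's and coprimality statements, $a$ may be replaced by any integer representative of its class modulo $N$.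
   Formalization: The isomorphism of the mobility group with l_DCY Z ⊕ l_DCY Z is stated for N > 1, since for N = 1 the ring R is zero and Λ is trivial; for every N ≥ 1 the exponents (i,j) of the monomials in the mobility group are shown to form l_DCY Z × l_DCY Z. *)

theory Defs
  imports "HOL-Algebra.Algebra" "HOL-Library.Product_Plus" "HOL-Number_Theory.Cong"
begin

text \<open>
  The ring \<open>A[x\<^sup>\<plusminus>, y\<^sup>\<plusminus>]\<close>: a Laurent polynomial is its
  finitely supported coefficient function on exponent vectors \<open>(i, j)\<close>, and
  multiplication is convolution.
\<close>

definition laurent_supp :: "('a, 'm) ring_scheme \<Rightarrow> (int \<times> int \<Rightarrow> 'a) \<Rightarrow> (int \<times> int) set"
  where "laurent_supp A p = {v. p v \<noteq> \<zero>\<^bsub>A\<^esub>}"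

definition laurent_ring :: "('a, 'm) ring_scheme \<Rightarrow> (int \<times> int \<Rightarrow> 'a) ring"
  where "laurent_ring A =
    \<lparr>carrier = {p. (\<forall>v. p v \<in> carrier A) \<and> finite (laurent_supp A p)},
     monoid.mult = (\<lambda>p q v. \<Oplus>\<^bsub>A\<^esub>u\<in>laurent_supp A p. p u \<otimes>\<^bsub>A\<^esub> q (v - u)),
     monoid.one = (\<lambda>v. if v = (0, 0) then \<one>\<^bsub>A\<^esub> else \<zero>\<^bsub>A\<^esub>),
     ring.zero = (\<lambda>v. \<zero>\<^bsub>A\<^esub>),
     ring.add = (\<lambda>p q v. p v \<oplus>\<^bsub>A\<^esub> q v)\<rparr>"

definition laurent_const :: "('a, 'm) ring_scheme \<Rightarrow> 'a \<Rightarrow> int \<times> int \<Rightarrow> 'a"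
  where "laurent_const A c = (\<lambda>v. if v = (0, 0) then c else \<zero>\<^bsub>A\<^esub>)"

definition laurent_monom :: "('a, 'm) ring_scheme \<Rightarrow> int \<Rightarrow> int \<Rightarrow> int \<times> int \<Rightarrow> 'a"
  where "laurent_monom A i j = (\<lambda>v. if v = (i, j) then \<one>\<^bsub>A\<^esub> else \<zero>\<^bsub>A\<^esub>)"

text \<open>
  \<^term>\<open>ZFact (int N)\<close> is \<open>\<int>/N\<int>\<close> for every \<open>N > 0\<close>; for \<open>N = 1\<close> it is the zero ring.
\<close>

type_synonym laurent = "int \<times> int \<Rightarrow> int set"

definition LR :: "nat \<Rightarrow> laurent ring"
  where "LR N = laurent_ring (ZFact (int N))"

definition monom_xy :: "nat \<Rightarrow> int \<Rightarrow> int \<Rightarrow> laurent"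
  where "monom_xy N i j = laurent_monom (ZFact (int N)) i j"

abbreviation var_x :: "nat \<Rightarrow> laurent"
  where "var_x N \<equiv> monom_xy N 1 0"

abbreviation var_y :: "nat \<Rightarrow> laurent"
  where "var_y N \<equiv> monom_xy N 0 1"

definition scalar :: "nat \<Rightarrow> int \<Rightarrow> laurent"
  where "scalar N a = laurent_const (ZFact (int N)) (ZMod (int N) a)"

text \<open>
  The translations form a subgroup of the unit group of \<^term>\<open>LR N\<close>. For \<open>N > 1\<close> distinct
  exponent vectors give distinct monomials; for \<open>N = 1\<close> all monomials coincide, and only
  the exponent vectors distinguish translations.
\<close>

definition translation_group :: "nat \<Rightarrow> laurent monoid"
  where "translation_group N =
    (units_of (LR N))\<lparr>carrier := {monom_xy N i j | i j. True}\<rparr>"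

definition mobility_group :: "nat \<Rightarrow> laurent \<Rightarrow> laurent \<Rightarrow> laurent set"
  where "mobility_group N f g =
    {t \<in> carrier (translation_group N).
       t \<ominus>\<^bsub>LR N\<^esub> \<one>\<^bsub>LR N\<^esub> \<in> Idl\<^bsub>LR N\<^esub> {f, g}}"

definition period_x :: "nat \<Rightarrow> laurent \<Rightarrow> laurent \<Rightarrow> nat"
  where "period_x N f g = (LEAST \<alpha>. 0 < \<alpha> \<and>
    (var_x N [^]\<^bsub>LR N\<^esub> \<alpha>) \<ominus>\<^bsub>LR N\<^esub> \<one>\<^bsub>LR N\<^esub> \<in> Idl\<^bsub>LR N\<^esub> {f, g})"

definition period_y :: "nat \<Rightarrow> laurent \<Rightarrow> laurent \<Rightarrow> nat"
  where "period_y N f g = (LEAST \<beta>. 0 < \<beta> \<and>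
    (var_y N [^]\<^bsub>LR N\<^esub> \<beta>) \<ominus>\<^bsub>LR N\<^esub> \<one>\<^bsub>LR N\<^esub> \<in> Idl\<^bsub>LR N\<^esub> {f, g})"

text \<open>
  The parameter \<open>a \<in> \<int>/N\<int>\<close> is given by an arbitrary integer representative.
\<close>

definition dcy_poly :: "nat \<Rightarrow> int \<Rightarrow> laurent \<Rightarrow> laurent"
  where "dcy_poly N a t =
    (t [^]\<^bsub>LR N\<^esub> (2::nat) \<ominus>\<^bsub>LR N\<^esub> (scalar N a \<oplus>\<^bsub>LR N\<^esub> \<one>\<^bsub>LR N\<^esub>) \<otimes>\<^bsub>LR N\<^esub> t)
      \<oplus>\<^bsub>LR N\<^esub> scalar N a"

definition dcy_f :: "nat \<Rightarrow> int \<Rightarrow> laurent"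
  where "dcy_f N a = dcy_poly N a (var_x N)"

definition dcy_g :: "nat \<Rightarrow> int \<Rightarrow> laurent"
  where "dcy_g N a = dcy_poly N a (var_y N)"

definition coprime_part :: "nat \<Rightarrow> int \<Rightarrow> nat"
  where "coprime_part N a = Max {d. d dvd N \<and> coprime (int d) a}"

text \<open>
  The library's \<open>ord\<close> takes a natural-number base; here the base may be negative.
\<close>

definition mult_order :: "nat \<Rightarrow> int \<Rightarrow> nat"
  where "mult_order m a = (LEAST \<alpha>. 0 < \<alpha> \<and> [a ^ \<alpha> = 1] (mod int m))"

definition geom_sum :: "int \<Rightarrow> nat \<Rightarrow> int"
  where "geom_sum a \<alpha> = (\<Sum>m<\<alpha>. a ^ m)"

text \<open>The quotient is exact, as the gcd divides \<^term>\<open>coprime_part N a\<close>.\<close>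

definition dcy_period :: "nat \<Rightarrow> int \<Rightarrow> nat"
  where "dcy_period N a =
    (let Na = coprime_part N a; r = mult_order Na a
     in r * (Na div nat (gcd (geom_sum a r) (int Na))))"

definition multiples_group :: "nat \<Rightarrow> int monoid"
  where "multiples_group l = integer_group\<lparr>carrier := {k. int l dvd k}\<rparr>"

end

theory Submission
  imports Defs "HOL-Number_Theory.Residues"
begin

text \<open>
  Modulo \<open>x - a\<close> the variable \<open>x\<close> becomes \<open>a\<close>, and its invertibility turns \<open>\<int>/N\<close> into
  \<open>\<int>/N\<^sub>a\<close>; so \<open>x\<^sup>\<alpha> - 1 = (x - 1) (1 + \<dots> + x\<^bsup>\<alpha>-1\<^esup>)\<close> lies in the ideal iff \<open>N\<^sub>a\<close> divides
  \<open>G\<^sub>\<alpha>\<close>. For sufficiency, \<open>x\<^sup>\<alpha> - 1 \<equiv> G\<^sub>\<alpha> (x - 1)\<close> modulo \<open>f\<close>, and \<open>x\<^sup>k (x - 1) \<equiv> a\<^sup>k (x - 1)\<close> is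
  killed by \<open>N\<^sub>a\<close> as soon as \<open>N\<close> divides \<open>N\<^sub>a a\<^sup>k\<close>. For necessity, the linear functionals
  \<open>x\<^sup>i y\<^sup>j \<mapsto> G\<^sub>i\<close> and \<open>x\<^sup>i y\<^sup>j \<mapsto> G\<^sub>j\<close> vanish modulo \<open>N\<^sub>a\<close> on the ideal. Finally \<open>N\<^sub>a dvd G\<^sub>\<alpha>\<close>
  forces \<open>\<alpha> = r k\<close> with \<open>r\<close> the order of \<open>a\<close>, and \<open>G\<^bsub>r k\<^esub> \<equiv> k G\<^sub>r\<close>.
  Computations take place in \<open>\<int>[x\<^sup>\<plusminus>, y\<^sup>\<plusminus>]\<close>, which maps onto the ring of the model by
  coefficientwise reduction.
\<close>

section \<open>Laurent polynomials as images of integer Laurent polynomials\<close>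

type_synonym zlaurent = "(int \<times> int, int) poly_mapping"

abbreviation zmon :: "int \<Rightarrow> int \<Rightarrow> zlaurent"
  where "zmon i j \<equiv> Poly_Mapping.single (i, j) 1"

text \<open>Finitely supported maps on the group Z^2 have convolution as their class multiplication,
  so ring identities are proved there by simplification and transported through
  \<open>reduce\<close>.\<close>

definition reduce :: "nat \<Rightarrow> zlaurent \<Rightarrow> laurent"
  where "reduce N p = (\<lambda>v. ZMod (int N) (Poly_Mapping.lookup p v))"

lemma ZMod_hom: "ZMod k \<in> ring_hom \<Z> (ZFact k)"
proof -
  have "(+>\<^bsub>\<Z>\<^esub>) (Idl\<^bsub>\<Z>\<^esub> {k}) \<in> ring_hom \<Z> (\<Z> Quot (Idl\<^bsub>\<Z>\<^esub> {k}))"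
    by (rule ideal.rcos_ring_hom) (simp add: int.genideal_ideal)
  thus ?thesis by (simp add: ZMod_def[abs_def] ZFact_def)
qed

lemma ZMod_add: "ZMod k a \<oplus>\<^bsub>ZFact k\<^esub> ZMod k b = ZMod k (a + b)"
  using ring_hom_add[OF ZMod_hom, of a b k] by simp

lemma ZMod_mult: "ZMod k a \<otimes>\<^bsub>ZFact k\<^esub> ZMod k b = ZMod k (a * b)"
  using ring_hom_mult[OF ZMod_hom, of a b k] by simp

lemma ZMod_one: "\<one>\<^bsub>ZFact k\<^esub> = ZMod k 1"
  using ring_hom_one[OF ZMod_hom, of k] by simp

lemma ZMod_zero: "\<zero>\<^bsub>ZFact k\<^esub> = ZMod k 0"
  using ring_hom_zero[OF ZMod_hom int.ring_axioms cring.axioms(1)[OF ZFact_is_cring], of k] by simp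

lemma carrier_ZFact: "carrier (ZFact k) = range (ZMod k)"
  by (auto simp: ZFact_def FactRing_def A_RCOSETS_def' ZMod_def)

lemma ZMod_finsum:
  assumes "finite S"
  shows "(\<Oplus>\<^bsub>ZFact k\<^esub>u\<in>S. ZMod k (h u)) = ZMod k (\<Sum>u\<in>S. h u)"
proof -
  interpret cring "ZFact k" by (rule ZFact_is_cring)
  show ?thesis
    using assms
    by (induction S) (auto simp: ZMod_zero ZMod_add carrier_ZFact)
qed

text \<open>The equation v = u + w determines w as v - u, which collapses the double sum to the
  convolution sum of \<open>laurent_ring\<close>.\<close>

lemma lookup_mult_keys:
  fixes p q :: zlaurent
  shows "Poly_Mapping.lookup (p * q) v =
    (\<Sum>u\<in>Poly_Mapping.keys p. Poly_Mapping.lookup p u * Poly_Mapping.lookup q (v - u))"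
proof -
  have *: "(\<Sum>w. Poly_Mapping.lookup q w when v = u + w) = Poly_Mapping.lookup q (v - u)" for u
  proof -
    have "(v = u + w) = (w = v - u)" for w by (auto simp: algebra_simps)
    thus ?thesis by simp
  qed
  show ?thesis
    unfolding lookup_mult *
    by (rule Sum_any.expand_superset) (auto simp: in_keys_iff)
qed

lemma reduce_eq_iff:
  "reduce N p = reduce N q \<longleftrightarrow>
    (\<forall>v. [Poly_Mapping.lookup p v = Poly_Mapping.lookup q v] (mod int N))"
  by (simp add: reduce_def fun_eq_iff ZMod_eq_mod cong_def)

lemma laurent_supp_reduce: "laurent_supp (ZFact (int N)) (reduce N p) \<subseteq> Poly_Mapping.keys p"
  by (auto simp: laurent_supp_def reduce_def ZMod_zero in_keys_iff)

lemma carrier_LR: "carrier (LR N) = range (reduce N)"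
proof (intro equalityI subsetI)
  fix p assume "p \<in> carrier (LR N)"
  hence p: "\<And>v. p v \<in> range (ZMod (int N))" and fin: "finite (laurent_supp (ZFact (int N)) p)"
    by (auto simp: LR_def laurent_ring_def carrier_ZFact)
  \<comment> \<open>Zero classes must be represented by 0: otherwise the chosen representatives
    could be nonzero multiples of N at infinitely many exponents.\<close>
  define h where "h v = (if p v = ZMod (int N) 0 then 0 else SOME c. p v = ZMod (int N) c)" for v
  have h: "ZMod (int N) (h v) = p v" for v
    using p[of v] someI_ex[of "\<lambda>c. p v = ZMod (int N) c"] by (auto simp: h_def)
  have "finite {v. h v \<noteq> 0}"
    by (rule finite_subset[OF _ fin]) (auto simp: h_def laurent_supp_def ZMod_zero)
  hence "reduce N (Abs_poly_mapping h) = p"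
    by (simp add: reduce_def h)
  thus "p \<in> range (reduce N)" by blast
next
  fix p assume "p \<in> range (reduce N)"
  thus "p \<in> carrier (LR N)"
    using finite_subset[OF laurent_supp_reduce finite_keys]
    by (auto simp: LR_def laurent_ring_def carrier_ZFact) (auto simp: reduce_def)
qed

lemma reduce_closed [simp, intro]: "reduce N p \<in> carrier (LR N)"
  by (simp add: carrier_LR)

lemma reduce_add: "reduce N p \<oplus>\<^bsub>LR N\<^esub> reduce N q = reduce N (p + q)"
  by (simp add: LR_def laurent_ring_def reduce_def lookup_add ZMod_add)

lemma reduce_mult: "reduce N p \<otimes>\<^bsub>LR N\<^esub> reduce N q = reduce N (p * q)"
proof
  fix v
  interpret cring "ZFact (int N)" by (rule ZFact_is_cring)
  have "(reduce N p \<otimes>\<^bsub>LR N\<^esub> reduce N q) v =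
    (\<Oplus>\<^bsub>ZFact (int N)\<^esub>u\<in>laurent_supp (ZFact (int N)) (reduce N p).
      reduce N p u \<otimes>\<^bsub>ZFact (int N)\<^esub> reduce N q (v - u))"
    by (simp add: LR_def laurent_ring_def)
  \<comment> \<open>Reduction can shrink the support; the extra terms over the keys of p
    vanish.\<close>
  also have "\<dots> = (\<Oplus>\<^bsub>ZFact (int N)\<^esub>u\<in>Poly_Mapping.keys p.
      reduce N p u \<otimes>\<^bsub>ZFact (int N)\<^esub> reduce N q (v - u))"
    by (rule add.finprod_mono_neutral_cong_left)
      (use laurent_supp_reduce in \<open>auto simp: laurent_supp_def reduce_def carrier_ZFact ZMod_mult\<close>)
  also have "\<dots> = reduce N (p * q) v"
    by (simp add: reduce_def ZMod_mult ZMod_finsum lookup_mult_keys)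
  finally show "(reduce N p \<otimes>\<^bsub>LR N\<^esub> reduce N q) v = reduce N (p * q) v" .
qed

lemma reduce_zero: "\<zero>\<^bsub>LR N\<^esub> = reduce N 0"
  by (simp add: LR_def laurent_ring_def reduce_def ZMod_zero)

lemma reduce_one: "\<one>\<^bsub>LR N\<^esub> = reduce N 1"
  by (auto simp: LR_def laurent_ring_def reduce_def ZMod_zero ZMod_one lookup_one
      zero_prod_def when_def fun_eq_iff)

text \<open>Every element is a \<open>reduce\<close> image, so each axiom is inherited from the
  integer Laurent polynomials.\<close>

lemma LR_cring: "cring (LR N)"
proof (rule cringI)
  show "abelian_group (LR N)"
  proof (rule abelian_groupI)
    fix x assume "x \<in> carrier (LR N)"
    then obtain p where "x = reduce N p" by (auto simp: carrier_LR)
    hence "reduce N (- p) \<oplus>\<^bsub>LR N\<^esub> x = \<zero>\<^bsub>LR N\<^esub>" by (simp add: reduce_add reduce_zero)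
    thus "\<exists>y\<in>carrier (LR N). y \<oplus>\<^bsub>LR N\<^esub> x = \<zero>\<^bsub>LR N\<^esub>" by blast
  qed (auto simp: carrier_LR reduce_add reduce_zero algebra_simps)
  show "comm_monoid (LR N)"
    by (rule comm_monoidI) (auto simp: carrier_LR reduce_mult reduce_one algebra_simps)
qed (auto simp: carrier_LR reduce_add reduce_mult algebra_simps)

lemma reduce_minus: "reduce N p \<ominus>\<^bsub>LR N\<^esub> reduce N q = reduce N (p - q)"
proof -
  interpret cring "LR N" by (rule LR_cring)
  have "\<ominus>\<^bsub>LR N\<^esub> reduce N q = reduce N (- q)"
    by (rule minus_equality) (simp_all add: reduce_add reduce_zero)
  thus ?thesis by (simp add: a_minus_def reduce_add)
qed

lemma reduce_pow: "reduce N p [^]\<^bsub>LR N\<^esub> (n::nat) = reduce N (p ^ n)"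
  by (induction n) (simp_all add: nat_pow_def reduce_one reduce_mult mult.commute)

lemma monom_xy_reduce: "monom_xy N i j = reduce N (zmon i j)"
  by (auto simp: monom_xy_def laurent_monom_def reduce_def ZMod_zero ZMod_one lookup_single
      when_def fun_eq_iff)

lemma scalar_reduce: "scalar N a = reduce N (of_int a)"
  by (auto simp: scalar_def laurent_const_def reduce_def ZMod_zero lookup_of_int
      when_def fun_eq_iff zero_prod_def)

lemma zmon_mult: "zmon i j * zmon i' j' = zmon (i + i') (j + j')"
  by (simp add: mult_single)

lemma zmon_0: "zmon 0 0 = 1"
  by (simp flip: single_one add: zero_prod_def)

lemma zmon_pow: "zmon i j ^ n = zmon (int n * i) (int n * j)"
  by (induction n) (simp_all add: zmon_0 zmon_mult algebra_simps)

definition dcy_lift :: "int \<Rightarrow> zlaurent \<Rightarrow> zlaurent"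
  where "dcy_lift a t = (t - 1) * (t - of_int a)"

lemma dcy_poly_reduce: "dcy_poly N a (reduce N t) = reduce N (dcy_lift a t)"
  by (simp add: dcy_poly_def scalar_reduce reduce_add reduce_mult reduce_minus reduce_one
      reduce_pow dcy_lift_def algebra_simps power2_eq_square)

lemma dcy_f_reduce: "dcy_f N a = reduce N (dcy_lift a (zmon 1 0))"
  by (simp add: dcy_f_def monom_xy_reduce dcy_poly_reduce)

lemma dcy_g_reduce: "dcy_g N a = reduce N (dcy_lift a (zmon 0 1))"
  by (simp add: dcy_g_def monom_xy_reduce dcy_poly_reduce)

lemma dcy_poly_factor:
  "dcy_poly N a (monom_xy N i j) =
    (monom_xy N i j \<ominus>\<^bsub>LR N\<^esub> \<one>\<^bsub>LR N\<^esub>) \<otimes>\<^bsub>LR N\<^esub> (monom_xy N i j \<ominus>\<^bsub>LR N\<^esub> scalar N a)"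
  by (simp add: monom_xy_reduce dcy_poly_reduce scalar_reduce reduce_mult reduce_minus
      reduce_one dcy_lift_def)

section \<open>Linear functionals and ideal membership\<close>

text \<open>The Z-linear extension of a weight on monomials; it serves to detect elements outside an
  ideal.\<close>

definition lin :: "(int \<times> int \<Rightarrow> int) \<Rightarrow> zlaurent \<Rightarrow> int"
  where "lin w p = (\<Sum>v\<in>Poly_Mapping.keys p. Poly_Mapping.lookup p v * w v)"

lemma lin_superset:
  "finite S \<Longrightarrow> Poly_Mapping.keys p \<subseteq> S \<Longrightarrow> lin w p = (\<Sum>v\<in>S. Poly_Mapping.lookup p v * w v)"
  unfolding lin_def by (rule sum.mono_neutral_left) (auto simp: in_keys_iff)

lemma lin_diff: "lin w (p - q) = lin w p - lin w q"
proof -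
  let ?S = "Poly_Mapping.keys p \<union> Poly_Mapping.keys q"
  have "lin w (p - q) = (\<Sum>v\<in>?S. Poly_Mapping.lookup (p - q) v * w v)"
    by (rule lin_superset) (auto simp: keys_diff)
  thus ?thesis
    by (simp add: lin_superset[of ?S] lookup_minus algebra_simps sum_subtractf)
qed

lemma lin_zero [simp]: "lin w 0 = 0"
  by (simp add: lin_def)

lemma lin_add: "lin w (p + q) = lin w p + lin w q"
  using lin_diff[of w p "- q"] lin_diff[of w 0 q] by simp

lemma lin_single [simp]: "lin w (Poly_Mapping.single u c) = c * w u"
  by (simp add: lin_def)

lemma lin_single_mult: "lin w (Poly_Mapping.single u c * q) = c * lin (\<lambda>v. w (u + v)) q"
  using subset_refl[of "Poly_Mapping.keys q"]
  by (induction q rule: frag_induction)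
    (simp_all add: mult_single right_diff_distrib lin_diff)

lemma dvd_lin:
  assumes "\<And>v. d dvd Poly_Mapping.lookup p v * w v"
  shows "d dvd lin w p"
  unfolding lin_def by (rule dvd_sum) (rule assms)

text \<open>A linear functional need not respect multiplication, so the generators are tested on all
  their monomial multiples. The s for which the functional is divisible by n on every multiple of s
  form an ideal, and n dvd N makes the answer independent of the lift.\<close>

lemma dvd_lin_if_mem_Idl:
  assumes "int n dvd int N"
    and x: "\<And>v. int n dvd lin w (p * Poly_Mapping.single v 1)"
    and y: "\<And>v. int n dvd lin w (q * Poly_Mapping.single v 1)"
    and mem: "reduce N r \<in> Idl\<^bsub>LR N\<^esub> {reduce N p, reduce N q}"
  shows "int n dvd lin w r"
proof -
  interpret cring "LR N" by (rule LR_cring)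
  define K where "K = {s. \<forall>t. int n dvd lin w (s * t)}"
  have K: "s \<in> K" if "\<And>v. int n dvd lin w (s * Poly_Mapping.single v 1)" for s
  proof -
    have "int n dvd lin w (s * t)" for t
      using subset_refl[of "Poly_Mapping.keys t"]
      by (induction t rule: frag_induction)
        (use that in \<open>simp_all add: right_diff_distrib lin_diff\<close>)
    thus ?thesis by (simp add: K_def)
  qed
  have K_mult: "s * t \<in> K" if "s \<in> K" for s t
    using that by (auto simp: K_def mult.assoc)
  have K_add: "s + t \<in> K" if "s \<in> K" "t \<in> K" for s t
    using that by (auto simp: K_def lin_add distrib_right)
  have "ideal (reduce N ` K) (LR N)"
  proof (rule idealI)
    show "subgroup (reduce N ` K) (add_monoid (LR N))"
    proof (rule add.subgroupI)
      have "0 \<in> K" by (simp add: K_def)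
      thus "reduce N ` K \<noteq> {}" by blast
      fix u assume "u \<in> reduce N ` K"
      then obtain s where s: "s \<in> K" "u = reduce N s" by blast
      have "\<ominus>\<^bsub>LR N\<^esub> u = reduce N (s * (- 1))"
        using s by (intro minus_equality) (simp_all add: reduce_add reduce_zero)
      thus "\<ominus>\<^bsub>LR N\<^esub> u \<in> reduce N ` K" using K_mult[OF s(1)] by blast
    qed (auto simp: reduce_add intro!: K_add imageI)
  next
    fix u x assume "u \<in> reduce N ` K" "x \<in> carrier (LR N)"
    then obtain s t where s: "s \<in> K" "u = reduce N s" "x = reduce N t"
      by (auto simp: carrier_LR)
    thus "u \<otimes>\<^bsub>LR N\<^esub> x \<in> reduce N ` K"
      using K_mult[of s t] by (auto simp: reduce_mult)
    with s show "x \<otimes>\<^bsub>LR N\<^esub> u \<in> reduce N ` K"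
      by (simp add: reduce_mult mult.commute)
  qed (rule ring_axioms)
  moreover have "{reduce N p, reduce N q} \<subseteq> reduce N ` K"
    using K[OF x] K[OF y] by blast
  ultimately have "reduce N r \<in> reduce N ` K"
    using genideal_minimal mem by blast
  then obtain s where s: "s \<in> K" "reduce N r = reduce N s" by blast
  \<comment> \<open>The lifts r and s of the same element differ by a multiple of N in each
    coefficient.\<close>
  have "int n dvd lin w (r - s)"
  proof (rule dvd_lin)
    fix v
    have "int N dvd Poly_Mapping.lookup (r - s) v"
      using s(2) unfolding reduce_eq_iff cong_iff_dvd_diff lookup_minus by blast
    with assms(1) show "int n dvd Poly_Mapping.lookup (r - s) v * w v"
      using dvd_trans by auto
  qed
  moreover have "int n dvd lin w (s * 1)" using s(1) unfolding K_def by blast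
  ultimately show ?thesis using dvd_add[of "int n" "lin w r - lin w s" "lin w s"] by (simp add: lin_diff)
qed

text \<open>Multiplication by (t - 1)(t - a) acts on weights as the second-order difference operator
  with characteristic roots 1 and a in direction (i, j).\<close>

lemma lin_dcy_lift:
  "lin w (dcy_lift a (zmon i j) * Poly_Mapping.single v 1) =
    w ((2 * i, 2 * j) + v) - (a + 1) * w ((i, j) + v) + a * w v"
proof -
  have "dcy_lift a (zmon i j) =
      zmon (2 * i) (2 * j) - Poly_Mapping.single (i, j) (a + 1) + Poly_Mapping.single 0 a"
    unfolding dcy_lift_def
    by (simp add: algebra_simps zmon_mult single_add mult_single flip: single_of_int)
  thus ?thesis
    by (simp add: distrib_right left_diff_distrib lin_add lin_diff lin_single_mult)
qed

section \<open>Coprime part, multiplicative order and geometric sums\<close>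

lemma
  assumes "0 < N"
  shows coprime_part_dvd: "coprime_part N a dvd N"
    and coprime_coprime_part: "coprime (int (coprime_part N a)) a"
    and coprime_part_greatest: "\<And>d. d dvd N \<Longrightarrow> coprime (int d) a \<Longrightarrow> d \<le> coprime_part N a"
proof -
  let ?D = "{d. d dvd N \<and> coprime (int d) a}"
  have fin: "finite ?D"
    by (rule finite_subset[of _ "{..N}"]) (use assms dvd_imp_le in auto)
  have "1 \<in> ?D" by simp
  hence "Max ?D \<in> ?D" using Max_in[OF fin] by blast
  thus "coprime_part N a dvd N" "coprime (int (coprime_part N a)) a"
    by (simp_all add: coprime_part_def)
  show "\<And>d. d dvd N \<Longrightarrow> coprime (int d) a \<Longrightarrow> d \<le> coprime_part N a"
    unfolding coprime_part_def by (rule Max_ge[OF fin]) simp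
qed

lemma coprime_part_pos: "0 < N \<Longrightarrow> 0 < coprime_part N a"
  using coprime_part_dvd[of N a] by (auto intro!: Nat.gr0I)

text \<open>One factor a absorbs one prime factor of m, so induction over the prime factorisation
  suffices.\<close>

lemma dvd_power_if_prime_divisors_dvd:
  fixes m :: nat and a :: int
  assumes "m \<noteq> 0" "\<And>p. Factorial_Ring.prime p \<Longrightarrow> p dvd m \<Longrightarrow> int p dvd a"
  shows "\<exists>k. int m dvd a ^ k"
  using assms
proof (induction m rule: prime_divisors_induct)
  case (factor p m)
  then obtain k where "int m dvd a ^ k" by auto
  moreover have "int p dvd a" using factor by simp
  ultimately have "int (p * m) dvd a ^ Suc k" by (simp add: mult_dvd_mono)
  thus ?case by blast
qed auto

text \<open>A prime p of N / N_a not dividing a would make N_a p a larger divisor of N coprime to a.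
  Hence the cofactor N / N_a divides a power of a.\<close>

lemma dvd_coprime_part_mult_power:
  assumes "0 < N"
  shows "\<exists>k. int N dvd int (coprime_part N a) * a ^ k"
proof -
  obtain m where m: "N = coprime_part N a * m"
    using coprime_part_dvd[OF assms] by (rule dvdE)
  have "int p dvd a" if p: "Factorial_Ring.prime p" "p dvd m" for p
  proof (rule ccontr)
    assume "\<not> int p dvd a"
    hence "coprime (int p) a" using p(1) by (simp add: prime_imp_coprime)
    hence "coprime (int (coprime_part N a * p)) a"
      using coprime_coprime_part[OF assms] by simp
    moreover have "coprime_part N a * p dvd N"
      by (subst m) (rule mult_dvd_mono[OF dvd_refl p(2)])
    ultimately have "coprime_part N a * p \<le> coprime_part N a"
      using coprime_part_greatest[OF assms] by blast
    thus False using coprime_part_pos[OF assms, of a] prime_gt_1_nat[OF p(1)] by auto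
  qed
  moreover have "m \<noteq> 0" using m assms by (intro notI) simp
  ultimately obtain k where "int m dvd a ^ k"
    using dvd_power_if_prime_divisors_dvd by blast
  hence "int N dvd int (coprime_part N a) * a ^ k"
    by (subst m) (simp add: mult_dvd_mono)
  thus ?thesis ..
qed

text \<open>Euler's theorem provides an exponent, so the \<open>LEAST\<close> is attained; division
  with remainder and minimality then give the divisibility.\<close>

lemma
  assumes "0 < n" "coprime (int n) a"
  shows mult_order_pos: "0 < mult_order n a"
    and mult_order_cong: "[a ^ mult_order n a = 1] (mod int n)"
    and mult_order_dvd: "\<And>k. [a ^ k = 1] (mod int n) \<Longrightarrow> mult_order n a dvd k"
proof -
  let ?P = "\<lambda>k. 0 < k \<and> [a ^ k = 1] (mod int n)"
  have "?P (totient n)"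
  \<comment> \<open>The \<open>residues\<close> locale requires a modulus above 1; modulo 1 every
    congruence holds.\<close>
  proof (cases "n = 1")
    case False
    hence "residues (int n)" using assms(1) by unfold_locales auto
    thus ?thesis
      using residues.euler_theorem[of "int n" a] assms by (simp add: coprime_commute)
  qed simp
  hence P: "?P (mult_order n a)" unfolding mult_order_def by (rule LeastI)
  thus pos: "0 < mult_order n a" and one: "[a ^ mult_order n a = 1] (mod int n)" by auto
  fix k assume k: "[a ^ k = 1] (mod int n)"
  let ?r = "mult_order n a"
  have "a ^ k = (a ^ ?r) ^ (k div ?r) * a ^ (k mod ?r)"
    by (simp flip: power_mult power_add)
  also have "[\<dots> = 1 ^ (k div ?r) * a ^ (k mod ?r)] (mod int n)"
    by (intro cong_mult cong_pow one cong_refl)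
  finally have "[a ^ (k mod ?r) = 1] (mod int n)"
    using k cong_sym cong_trans by fastforce
  moreover have "k mod ?r < ?r" using pos by simp
  ultimately have "k mod ?r = 0"
    using not_less_Least[of "k mod ?r" ?P] unfolding mult_order_def by auto
  thus "?r dvd k" by auto
qed

lemma geom_sum_0 [simp]: "geom_sum a 0 = 0"
  by (simp add: geom_sum_def)

lemma geom_sum_Suc: "geom_sum a (Suc k) = a * geom_sum a k + 1"
  by (simp add: geom_sum_def sum.lessThan_Suc_shift sum_distrib_left del: sum.lessThan_Suc)

lemma geom_sum_add: "geom_sum a (m + k) = geom_sum a m + a ^ m * geom_sum a k"
  by (induction m) (simp_all add: geom_sum_Suc algebra_simps)

lemma geom_sum_mult: "(a - 1) * geom_sum a k = a ^ k - 1"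
  by (simp add: geom_sum_def power_diff_1_eq)

text \<open>The sum falls into k blocks of length r, each of them G_r times a power of a^r, which is
  1 modulo n.\<close>

lemma geom_sum_mult_cong:
  assumes "[a ^ r = 1] (mod n)"
  shows "[geom_sum a (r * k) = int k * geom_sum a r] (mod n)"
proof (induction k)
  case (Suc k)
  have "[geom_sum a r + a ^ r * geom_sum a (r * k) =
      geom_sum a r + 1 * (int k * geom_sum a r)] (mod n)"
    by (intro cong_add cong_mult cong_refl assms Suc)
  thus ?case by (simp add: geom_sum_add algebra_simps)
qed simp

lemma dvd_mult_iff_div_gcd_dvd:
  fixes n k g :: int
  assumes "n \<noteq> 0"
  shows "n dvd k * g \<longleftrightarrow> n div gcd g n dvd k"
proof -
  define d where "d = gcd g n"
  have d: "d \<noteq> 0" using assms by (simp add: d_def)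
  obtain n' g' where n': "n = d * n'" "g = d * g'"
    unfolding d_def by (meson dvdE gcd_dvd1 gcd_dvd2)
  have "coprime (g div d) (n div d)"
    unfolding d_def using assms by (intro div_gcd_coprime) auto
  hence "coprime n' g'" using d n' by (simp add: coprime_commute)
  hence "n' dvd k * g' \<longleftrightarrow> n' dvd k" by (simp add: coprime_dvd_mult_left_iff)
  moreover have "n dvd k * g \<longleftrightarrow> n' dvd k * g'"
    using d by (simp add: n' mult.left_commute)
  moreover have "n div gcd g n = n'" unfolding d_def[symmetric] using d n' by simp
  ultimately show ?thesis by simp
qed

text \<open>The two factors of \<open>dcy_period\<close> encode two successive conditions: k = r j
  with r the order of a, and then n dvd j G_r, which says that n / gcd(G_r, n) divides j.\<close>

lemma geom_sum_dvd_iff: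
  assumes "0 < N"
  shows "int (coprime_part N a) dvd geom_sum a k \<longleftrightarrow> dcy_period N a dvd k"
proof -
  define n where "n = coprime_part N a"
  define r where "r = mult_order n a"
  define n' where "n' = n div nat (gcd (geom_sum a r) (int n))"
  have n: "0 < n" "coprime (int n) a"
    using coprime_part_pos coprime_coprime_part assms by (auto simp: n_def)
  have l: "dcy_period N a = r * n'" by (simp add: dcy_period_def Let_def n'_def r_def n_def)
  have n': "int n' = int n div gcd (geom_sum a r) (int n)"
    by (simp add: n'_def zdiv_int)
  have iff: "int n dvd geom_sum a (r * j) \<longleftrightarrow> n' dvd j" for j
  proof -
    have "[geom_sum a (r * j) = int j * geom_sum a r] (mod int n)"
      using geom_sum_mult_cong mult_order_cong[OF n] by (simp add: r_def)
    hence "int n dvd geom_sum a (r * j) \<longleftrightarrow> int n dvd int j * geom_sum a r"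
      by (metis cong_0_iff cong_sym cong_trans)
    also have "\<dots> \<longleftrightarrow> n' dvd j"
      using n by (simp add: dvd_mult_iff_div_gcd_dvd flip: n' int_dvd_int_iff)
    finally show ?thesis .
  qed
  \<comment> \<open>Here (a - 1) G_k = a^k - 1 turns divisibility of G_k into a congruence for
    a^k.\<close>
  have "r dvd k" if "int n dvd geom_sum a k"
    unfolding r_def
  proof (rule mult_order_dvd[OF n])
    show "[a ^ k = 1] (mod int n)"
      using that by (simp add: cong_iff_dvd_diff flip: geom_sum_mult)
  qed
  moreover have "r dvd k" if "r * n' dvd k" using that by (rule dvd_mult_left)
  moreover have "0 < r" using mult_order_pos[OF n] by (simp add: r_def)
  ultimately show ?thesis
    unfolding l n_def[symmetric] using iff by (metis dvd_def nat_mult_dvd_cancel1)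
qed

lemma dcy_period_pos:
  assumes "0 < N"
  shows "0 < dcy_period N a"
proof -
  define n where "n = coprime_part N a"
  have n: "0 < n" "coprime (int n) a"
    using coprime_part_pos coprime_coprime_part assms by (auto simp: n_def)
  let ?g = "gcd (geom_sum a (mult_order n a)) (int n)"
  have "nat ?g dvd n" by (simp add: nat_dvd_iff)
  hence "nat ?g \<le> n" using n by (auto intro: dvd_imp_le)
  hence "0 < n div nat ?g" using n by (simp add: div_greater_zero_iff)
  thus ?thesis
    using mult_order_pos[OF n] by (simp add: dcy_period_def Let_def n_def)
qed

text \<open>
  The geometric sum extended to negative arguments, with \<open>b\<close> an inverse of \<open>a\<close> modulo
  the coprime part: the solution of \<open>e (i + 1) = a * e i + 1\<close> with \<open>e 0 = 0\<close>.
\<close>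

definition geom_sum_int :: "int \<Rightarrow> int \<Rightarrow> int \<Rightarrow> int"
  where "geom_sum_int a b i =
    (if 0 \<le> i then geom_sum a (nat i) else - b * geom_sum b (nat (- i)))"

lemma geom_sum_int_step:
  assumes "[a * b = 1] (mod n)"
  shows "[geom_sum_int a b (i + 1) = a * geom_sum_int a b i + 1] (mod n)"
proof (cases "0 \<le> i")
  case True
  hence "nat (i + 1) = Suc (nat i)" by simp
  thus ?thesis using True by (simp add: geom_sum_int_def geom_sum_Suc)
next
  case False
  define m where "m = nat (- i - 1)"
  have i: "i = - int (Suc m)" using False by (simp add: m_def)
  \<comment> \<open>For m = 0 the index i + 1 = 0 falls into the other branch, and both sides are
    0.\<close>
  have "geom_sum_int a b (i + 1) = - (b * geom_sum b m)"
    by (cases m) (simp_all add: i geom_sum_int_def nat_add_distrib)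
  moreover have "a * geom_sum_int a b i + 1 = - ((a * b) * (b * geom_sum b m + 1)) + 1"
    by (simp add: i geom_sum_int_def geom_sum_Suc flip: of_nat_Suc)
  moreover have "[- ((a * b) * (b * geom_sum b m + 1)) + 1 = - (b * geom_sum b m)] (mod n)"
  proof -
    have "- ((a * b) * (b * geom_sum b m + 1)) + 1 - - (b * geom_sum b m) =
        (a * b - 1) * - (b * geom_sum b m + 1)"
      by (simp add: algebra_simps)
    thus ?thesis using assms unfolding cong_iff_dvd_diff by (simp only: dvd_mult2)
  qed
  ultimately show ?thesis by (simp add: cong_sym)
qed

section \<open>The ideal of the DCY model\<close>

text \<open>The pullback to integer Laurent polynomials is the ideal generated by N and the lifts of
  f and g.\<close>

definition dcy_ideal :: "nat \<Rightarrow> int \<Rightarrow> zlaurent set"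
  where "dcy_ideal N a = {p. reduce N p \<in> Idl\<^bsub>LR N\<^esub> {dcy_f N a, dcy_g N a}}"

lemma
  shows dcy_ideal_add: "p \<in> dcy_ideal N a \<Longrightarrow> q \<in> dcy_ideal N a \<Longrightarrow> p + q \<in> dcy_ideal N a"
    and dcy_ideal_mult: "p \<in> dcy_ideal N a \<Longrightarrow> p * s \<in> dcy_ideal N a"
    and dcy_ideal_x: "dcy_lift a (zmon 1 0) \<in> dcy_ideal N a"
    and dcy_ideal_y: "dcy_lift a (zmon 0 1) \<in> dcy_ideal N a"
    and dcy_ideal_modulus: "of_int (int N) \<in> dcy_ideal N a"
proof -
  interpret cring "LR N" by (rule LR_cring)
  have sub: "{dcy_f N a, dcy_g N a} \<subseteq> carrier (LR N)"
    by (simp add: dcy_f_reduce dcy_g_reduce)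
  interpret I: ideal "Idl\<^bsub>LR N\<^esub> {dcy_f N a, dcy_g N a}" "LR N"
    by (rule genideal_ideal[OF sub])
  show "p \<in> dcy_ideal N a \<Longrightarrow> q \<in> dcy_ideal N a \<Longrightarrow> p + q \<in> dcy_ideal N a"
    using I.a_closed by (auto simp: dcy_ideal_def simp flip: reduce_add)
  show "p \<in> dcy_ideal N a \<Longrightarrow> p * s \<in> dcy_ideal N a"
    using I.I_r_closed by (auto simp: dcy_ideal_def simp flip: reduce_mult)
  show "dcy_lift a (zmon 1 0) \<in> dcy_ideal N a" "dcy_lift a (zmon 0 1) \<in> dcy_ideal N a"
    using genideal_self[OF sub] by (auto simp: dcy_ideal_def dcy_f_reduce dcy_g_reduce)
  have "reduce N (of_int (int N)) = reduce N 0"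
    unfolding reduce_eq_iff by (simp only: lookup_of_int) (simp add: when_def cong_def)
  thus "of_int (int N) \<in> dcy_ideal N a"
    using I.zero_closed by (simp add: dcy_ideal_def reduce_zero)
qed

lemma dcy_ideal_cancel_unit:
  assumes "p * t \<in> dcy_ideal N a" "t * t' = 1"
  shows "p \<in> dcy_ideal N a"
  using dcy_ideal_mult[OF assms(1), of t'] assms(2) by (simp add: mult.assoc)

text \<open>An arbitrary unit t covers x and y at once. Invertibility removes the part of N built
  from primes dividing a; what remains is N_a, which divides the geometric sum.\<close>

lemma power_period_in_dcy_ideal:
  assumes "0 < N" and F: "dcy_lift a t \<in> dcy_ideal N a" and unit: "t * t' = 1"
  shows "t ^ dcy_period N a - 1 \<in> dcy_ideal N a"
proof -
  let ?n = "int (coprime_part N a)" and ?l = "dcy_period N a"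
  let ?a = "of_int a :: zlaurent"
  have pow: "\<exists>s. t ^ m - ?a ^ m = (t - ?a) * s" for m
    using power_diff_sumr2[of t m ?a] by blast
  obtain k where "int N dvd ?n * a ^ k" using dvd_coprime_part_mult_power[OF assms(1)] ..
  then obtain q where q: "?n * a ^ k = int N * q" by (rule dvdE)
  obtain s where s: "t ^ k - ?a ^ k = (t - ?a) * s" using pow by blast
  have "t ^ k = ?a ^ k + (t - ?a) * s" using s by (simp add: algebra_simps)
  \<comment> \<open>Modulo the lift, t acts on t - 1 as a, so t^k turns N_a (t - 1) into a multiple
    of N; the unit t^k is then cancelled.\<close>
  hence "of_int ?n * (t - 1) * t ^ k = of_int ?n * (t - 1) * (?a ^ k + (t - ?a) * s)" by simp
  also have "\<dots> = dcy_lift a t * (s * of_int ?n) + of_int (?n * a ^ k) * (t - 1)"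
    by (simp add: dcy_lift_def algebra_simps)
  also have "\<dots> \<in> dcy_ideal N a"
    unfolding q of_int_mult mult.assoc
    by (intro dcy_ideal_add dcy_ideal_mult F dcy_ideal_modulus)
  finally have n: "of_int ?n * (t - 1) \<in> dcy_ideal N a"
    by (rule dcy_ideal_cancel_unit[where t' = "t' ^ k"])
      (simp add: unit flip: power_mult_distrib)
  \<comment> \<open>The cofactors are fixed as a function of m so that they can be summed.\<close>
  obtain c where c: "\<And>m. t ^ m - ?a ^ m = (t - ?a) * c m" using pow by metis
  have "?n dvd geom_sum a ?l" using geom_sum_dvd_iff[OF assms(1)] by simp
  then obtain g where g: "geom_sum a ?l = ?n * g" by (rule dvdE)
  have "(\<Sum>m<?l. t ^ m) - of_int (geom_sum a ?l) = (\<Sum>m<?l. t ^ m - ?a ^ m)"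
    by (simp add: geom_sum_def sum_subtractf)
  also have "\<dots> = (t - ?a) * (\<Sum>m<?l. c m)" by (simp add: c sum_distrib_left)
  finally have "(\<Sum>m<?l. t ^ m) = (t - ?a) * (\<Sum>m<?l. c m) + of_int (?n * g)"
    by (simp add: g algebra_simps)
  hence "t ^ ?l - 1 = (t - 1) * ((t - ?a) * (\<Sum>m<?l. c m) + of_int (?n * g))"
    by (simp only: power_diff_1_eq)
  also have "\<dots> = dcy_lift a t * (\<Sum>m<?l. c m) + of_int ?n * (t - 1) * of_int g"
    by (simp add: dcy_lift_def algebra_simps)
  also have "\<dots> \<in> dcy_ideal N a"
    by (intro dcy_ideal_add dcy_ideal_mult F n)
  finally show ?thesis .
qed

text \<open>Together with the next two lemmas: the exponent vectors of monomials congruent to 1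
  modulo the ideal are closed under the group operations of Z^2.\<close>

lemma zmon_sub_one_add:
  assumes "zmon i j - 1 \<in> dcy_ideal N a" "zmon i' j' - 1 \<in> dcy_ideal N a"
  shows "zmon (i + i') (j + j') - 1 \<in> dcy_ideal N a"
proof -
  have "zmon (i + i') (j + j') - 1 = (zmon i j - 1) * zmon i' j' + (zmon i' j' - 1)"
    by (simp add: algebra_simps zmon_mult)
  thus ?thesis using assms by (simp only: dcy_ideal_add dcy_ideal_mult)
qed

lemma zmon_sub_one_uminus:
  assumes "zmon i j - 1 \<in> dcy_ideal N a"
  shows "zmon (- i) (- j) - 1 \<in> dcy_ideal N a"
proof -
  have "zmon (- i) (- j) - 1 = (zmon i j - 1) * (- zmon (- i) (- j))"
    by (simp add: algebra_simps zmon_mult zmon_0)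
  thus ?thesis using assms by (simp only: dcy_ideal_mult)
qed

lemma zmon_multiple_in_dcy_ideal:
  assumes "zmon i j - 1 \<in> dcy_ideal N a"
  shows "zmon (k * i) (k * j) - 1 \<in> dcy_ideal N a"
proof -
  have nat: "zmon (int m * i) (int m * j) - 1 \<in> dcy_ideal N a" for m
    unfolding zmon_pow[symmetric] power_diff_1_eq by (rule dcy_ideal_mult[OF assms])
  show ?thesis
    using nat[of "nat k"] zmon_sub_one_uminus[OF nat[of "nat (- k)"]] by (cases "0 \<le> k") auto
qed

text \<open>Each of two functionals reads off one exponent. Its weight, the geometric sum in that
  exponent, satisfies the recurrence with roots 1 and a modulo N_a, which kills the multiples of the
  generator in that variable. Along the other variable the weight is constant, and 1 - (a + 1) + a =
  0 suffices.\<close>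

lemma dcy_ideal_imp_dvd:
  assumes "0 < N" "zmon i j - 1 \<in> dcy_ideal N a"
  shows "int (dcy_period N a) dvd i" "int (dcy_period N a) dvd j"
proof -
  let ?n = "coprime_part N a"
  have "coprime a (int ?n)"
    using coprime_coprime_part[OF assms(1)] by (simp add: coprime_commute)
  then obtain b where b: "[a * b = 1] (mod int ?n)" using cong_solve_coprime_int by blast
  let ?e = "geom_sum_int a b"
  have rec: "int ?n dvd ?e (2 + i) - (a + 1) * ?e (1 + i) + a * ?e i" for i
  proof -
    \<comment> \<open>The inhomogeneous term 1 cancels in the difference of two consecutive
      first-order steps.\<close>
    have "int ?n dvd (?e (i + 1 + 1) - (a * ?e (i + 1) + 1)) - (?e (i + 1) - (a * ?e i + 1))"
      using geom_sum_int_step[OF b, of "i + 1"] geom_sum_int_step[OF b, of i]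
      unfolding cong_iff_dvd_diff by (rule dvd_diff)
    thus ?thesis by (simp add: algebra_simps)
  qed
  have triv: "?e i - (a + 1) * ?e i + a * ?e i = 0" for i by (simp add: algebra_simps)
  have lin: "int ?n dvd w (i, j) - w (0, 0)"
    if "zmon i j - 1 \<in> dcy_ideal N a" "w = ?e \<circ> fst \<or> w = ?e \<circ> snd" for w i j
  proof -
    have "int ?n dvd lin w (zmon i j - 1)"
    proof (rule dvd_lin_if_mem_Idl)
      show "reduce N (zmon i j - 1) \<in>
          Idl\<^bsub>LR N\<^esub> {reduce N (dcy_lift a (zmon 1 0)), reduce N (dcy_lift a (zmon 0 1))}"
        using that(1) by (simp add: dcy_ideal_def dcy_f_reduce dcy_g_reduce)
      show "int ?n dvd int N" using coprime_part_dvd[OF assms(1)] by simp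
    qed (use that(2) rec triv in \<open>auto simp: lin_dcy_lift\<close>)
    thus ?thesis by (simp add: lin_diff flip: single_one zero_prod_def)
  qed
  \<comment> \<open>\<open>geom_sum_dvd_iff\<close> concerns natural exponents, so a negative
    exponent is handled through the inverse monomial.\<close>
  have dvd: "int (dcy_period N a) dvd i" if "0 \<le> i" "int ?n dvd ?e i" for i
    using that geom_sum_dvd_iff[OF assms(1), of a "nat i"]
    by (simp add: geom_sum_int_def flip: int_dvd_int_iff)
  have e0: "?e 0 = 0" by (simp add: geom_sum_int_def)
  show "int (dcy_period N a) dvd i"
    using lin[OF assms(2), of "?e \<circ> fst"] dvd[of i] dvd[of "- i"]
      lin[OF zmon_sub_one_uminus[OF assms(2)], of "?e \<circ> fst"]
    by (cases "0 \<le> i") (auto simp: e0)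
  show "int (dcy_period N a) dvd j"
    using lin[OF assms(2), of "?e \<circ> snd"] dvd[of j] dvd[of "- j"]
      lin[OF zmon_sub_one_uminus[OF assms(2)], of "?e \<circ> snd"]
    by (cases "0 \<le> j") (auto simp: e0)
qed

lemma zmon_in_dcy_ideal_iff:
  assumes "0 < N"
  shows "zmon i j - 1 \<in> dcy_ideal N a \<longleftrightarrow>
    int (dcy_period N a) dvd i \<and> int (dcy_period N a) dvd j"
proof
  let ?l = "int (dcy_period N a)"
  assume "?l dvd i \<and> ?l dvd j"
  then obtain m k where "i = m * ?l" "j = k * ?l" by (metis dvd_def mult.commute)
  \<comment> \<open>The zero exponents are written as products to match
    \<open>zmon_multiple_in_dcy_ideal\<close>.\<close>
  moreover have "zmon (m * ?l) (m * 0) - 1 \<in> dcy_ideal N a"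
    using power_period_in_dcy_ideal[OF assms dcy_ideal_x, of "zmon (- 1) 0"]
    by (intro zmon_multiple_in_dcy_ideal) (simp add: zmon_mult zmon_0 zmon_pow)
  moreover have "zmon (k * 0) (k * ?l) - 1 \<in> dcy_ideal N a"
    using power_period_in_dcy_ideal[OF assms dcy_ideal_y, of "zmon 0 (- 1)"]
    by (intro zmon_multiple_in_dcy_ideal) (simp add: zmon_mult zmon_0 zmon_pow)
  ultimately show "zmon i j - 1 \<in> dcy_ideal N a"
    using zmon_sub_one_add by fastforce
qed (use dcy_ideal_imp_dvd[OF assms] in blast)

section \<open>Translations\<close>

lemma monom_xy_mult:
  "monom_xy N i j \<otimes>\<^bsub>LR N\<^esub> monom_xy N i' j' = monom_xy N (i + i') (j + j')"
  by (simp add: monom_xy_reduce reduce_mult zmon_mult)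

lemma monom_xy_pow:
  "monom_xy N i j [^]\<^bsub>LR N\<^esub> (k::nat) = monom_xy N (int k * i) (int k * j)"
  by (simp add: monom_xy_reduce reduce_pow zmon_pow)

lemma translation_group_simps [simp]:
  "carrier (translation_group N) = {monom_xy N i j | i j. True}"
  "s \<otimes>\<^bsub>translation_group N\<^esub> t = s \<otimes>\<^bsub>LR N\<^esub> t"
  "\<one>\<^bsub>translation_group N\<^esub> = monom_xy N 0 0"
  by (auto simp: translation_group_def units_of_def reduce_one monom_xy_reduce zmon_0)

lemma translation_group_group: "group (translation_group N)"
proof (rule groupI)
  fix s t assume "s \<in> carrier (translation_group N)" "t \<in> carrier (translation_group N)"
  thus "s \<otimes>\<^bsub>translation_group N\<^esub> t \<in> carrier (translation_group N)"
    by (auto simp: monom_xy_mult) blast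
next
  fix t assume "t \<in> carrier (translation_group N)"
  then obtain i j where "t = monom_xy N i j" by auto
  hence "monom_xy N (- i) (- j) \<otimes>\<^bsub>translation_group N\<^esub> t = \<one>\<^bsub>translation_group N\<^esub>"
    by (simp add: monom_xy_mult)
  thus "\<exists>s\<in>carrier (translation_group N).
      s \<otimes>\<^bsub>translation_group N\<^esub> t = \<one>\<^bsub>translation_group N\<^esub>"
    by force
qed (auto simp: monom_xy_mult add.assoc)

lemma translation_group_inv:
  "inv\<^bsub>translation_group N\<^esub> monom_xy N i j = monom_xy N (- i) (- j)"
  by (rule group.inv_equality[OF translation_group_group]) (auto simp: monom_xy_mult)

lemma translation_group_int_pow:
  "monom_xy N i j [^]\<^bsub>translation_group N\<^esub> (k::int) = monom_xy N (k * i) (k * j)"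
proof -
  have "monom_xy N i j [^]\<^bsub>translation_group N\<^esub> (m::nat) = monom_xy N (int m * i) (int m * j)" for m
    by (induction m) (simp_all add: nat_pow_def monom_xy_mult algebra_simps)
  thus ?thesis by (simp add: int_pow_def2 translation_group_inv)
qed

text \<open>At exponent (i, j) distinct monomials have coefficients 1 and 0, which are incongruent
  because N > 1.\<close>

lemma monom_xy_eq_iff:
  assumes "1 < N"
  shows "monom_xy N i j = monom_xy N i' j' \<longleftrightarrow> i = i' \<and> j = j'"
proof
  assume "monom_xy N i j = monom_xy N i' j'"
  hence "[1 = Poly_Mapping.lookup (zmon i' j') (i, j)] (mod int N)"
    unfolding monom_xy_reduce reduce_eq_iff by (metis lookup_single_eq)
  thus "i = i' \<and> j = j'"
    using assms by (auto simp: lookup_single when_def cong_iff_dvd_diff split: if_splits)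
qed simp

section \<open>The mobility group and the periods\<close>

lemma monom_xy_minus_one_in_Idl_iff:
  assumes "0 < N"
  shows "monom_xy N i j \<ominus>\<^bsub>LR N\<^esub> \<one>\<^bsub>LR N\<^esub> \<in> Idl\<^bsub>LR N\<^esub> {dcy_f N a, dcy_g N a} \<longleftrightarrow>
    int (dcy_period N a) dvd i \<and> int (dcy_period N a) dvd j"
  using zmon_in_dcy_ideal_iff[OF assms, of i j a]
  by (simp add: monom_xy_reduce reduce_one reduce_minus dcy_ideal_def)

text \<open>For N = 1 all monomials coincide, which is consistent because the period is then
  1.\<close>

lemma monom_xy_mem_mobility_group_iff:
  assumes "0 < N"
  shows "monom_xy N i j \<in> mobility_group N (dcy_f N a) (dcy_g N a) \<longleftrightarrow>
    int (dcy_period N a) dvd i \<and> int (dcy_period N a) dvd j"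
  using assms by (auto simp: mobility_group_def monom_xy_minus_one_in_Idl_iff)

lemma mobility_group_dcy:
  assumes "0 < N"
  shows "mobility_group N (dcy_f N a) (dcy_g N a) =
    {monom_xy N i j | i j. int (dcy_period N a) dvd i \<and> int (dcy_period N a) dvd j}"
  unfolding mobility_group_def translation_group_simps
  using monom_xy_minus_one_in_Idl_iff[OF assms] by blast

lemma subgroup_mobility_group_dcy:
  assumes "0 < N"
  shows "subgroup (mobility_group N (dcy_f N a) (dcy_g N a)) (translation_group N)"
proof (rule group.subgroupI[OF translation_group_group])
  let ?M = "mobility_group N (dcy_f N a) (dcy_g N a)"
  note mem = monom_xy_mem_mobility_group_iff[OF assms]
  show "?M \<subseteq> carrier (translation_group N)" by (auto simp: mobility_group_def)
  show "?M \<noteq> {}" using mem[of 0 0 a] by auto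
  fix s assume "s \<in> ?M"
  then obtain i j where s: "s = monom_xy N i j"
    "int (dcy_period N a) dvd i" "int (dcy_period N a) dvd j"
    by (auto simp: mobility_group_dcy[OF assms])
  thus "inv\<^bsub>translation_group N\<^esub> s \<in> ?M" by (simp add: translation_group_inv mem)
  fix t assume "t \<in> ?M"
  with s show "s \<otimes>\<^bsub>translation_group N\<^esub> t \<in> ?M"
    by (auto simp: mobility_group_dcy[OF assms] monom_xy_mult) (metis dvd_add)
qed

lemma Least_pos_dvd:
  fixes l :: nat
  assumes "0 < l"
  shows "(LEAST k. 0 < k \<and> l dvd k) = l"
  using assms by (intro Least_equality) (auto intro: dvd_imp_le)

lemma period_x_dcy:
  assumes "0 < N"
  shows "period_x N (dcy_f N a) (dcy_g N a) = dcy_period N a"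
  by (simp add: period_x_def monom_xy_pow monom_xy_minus_one_in_Idl_iff assms
      Least_pos_dvd dcy_period_pos)

lemma period_y_dcy:
  assumes "0 < N"
  shows "period_y N (dcy_f N a) (dcy_g N a) = dcy_period N a"
  by (simp add: period_y_def monom_xy_pow monom_xy_minus_one_in_Idl_iff assms
      Least_pos_dvd dcy_period_pos)

lemma mobility_group_dcy_eq_generate:
  assumes "0 < N"
  shows "mobility_group N (dcy_f N a) (dcy_g N a) =
    generate (translation_group N)
      {var_x N [^]\<^bsub>LR N\<^esub> dcy_period N a, var_y N [^]\<^bsub>LR N\<^esub> dcy_period N a}"
    (is "?M = generate ?T ?S")
proof
  let ?l = "int (dcy_period N a)"
  interpret T: group ?T by (rule translation_group_group)
  have S: "?S = {monom_xy N ?l 0, monom_xy N 0 ?l}" by (simp add: monom_xy_pow)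
  show "generate ?T ?S \<subseteq> ?M"
    by (rule T.generate_subgroup_incl[OF _ subgroup_mobility_group_dcy[OF assms]])
      (simp add: S monom_xy_mem_mobility_group_iff assms)
  have gen: "subgroup (generate ?T ?S) ?T"
    by (rule T.generate_is_subgroup) (auto simp: S)
  \<comment> \<open>Products of integer powers of the two generators already reach every element of
    the mobility group.\<close>
  have "monom_xy N (?l * m) (?l * k) \<in> generate ?T ?S" for m k
  proof -
    have "monom_xy N ?l 0 [^]\<^bsub>?T\<^esub> m \<otimes>\<^bsub>?T\<^esub> monom_xy N 0 ?l [^]\<^bsub>?T\<^esub> k \<in> generate ?T ?S"
      by (intro subgroup.m_closed[OF gen] T.subgroup_int_pow_closed[OF gen])
        (auto simp: S intro: generate.incl)
    thus ?thesis by (simp add: translation_group_int_pow monom_xy_mult mult.commute)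
  qed
  thus "?M \<subseteq> generate ?T ?S"
    by (auto simp: mobility_group_dcy[OF assms] elim!: dvdE)
qed

lemma multiples_group_group: "group (multiples_group l)"
  unfolding multiples_group_def
proof (rule group.subgroup_imp_group[OF group_integer_group])
  show "subgroup {k. int l dvd k} integer_group"
  proof (rule group.subgroupI[OF group_integer_group])
    fix k assume "k \<in> {k. int l dvd k}"
    moreover have "inv\<^bsub>integer_group\<^esub> k = - k"
      by (rule group.inv_equality[OF group_integer_group]) auto
    ultimately show "inv\<^bsub>integer_group\<^esub> k \<in> {k. int l dvd k}" by simp
  qed auto
qed

lemma mobility_group_dcy_iso:
  assumes "1 < N"
  shows "(translation_group N)\<lparr>carrier := mobility_group N (dcy_f N a) (dcy_g N a)\<rparr>
    \<cong> multiples_group (dcy_period N a) \<times>\<times> multiples_group (dcy_period N a)"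
proof -
  let ?G = "multiples_group (dcy_period N a) \<times>\<times> multiples_group (dcy_period N a)"
  let ?H = "(translation_group N)\<lparr>carrier := mobility_group N (dcy_f N a) (dcy_g N a)\<rparr>"
  \<comment> \<open>The map runs from exponents to monomials, the direction that needs no choice of
    exponents; symmetry then requires its source to be a group.\<close>
  have "(\<lambda>(i, j). monom_xy N i j) \<in> iso ?G ?H"
    using assms
    by (auto simp: iso_def hom_def bij_betw_def inj_on_def mobility_group_dcy multiples_group_def
        monom_xy_mult monom_xy_eq_iff)
  hence "?G \<cong> ?H" by (auto simp: is_iso_def)
  thus ?thesis
    by (rule group.iso_sym[OF DirProd_group[OF multiples_group_group multiples_group_group]])
qed

text \<open>The description by exponent vectors makes sense for every N > 0, while the isomorphism
  type is claimed for N > 1: for N = 1 the monomials collapse to a single element.\<close>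

theorem mainTheorem5:
  fixes N :: nat and a :: int
  assumes "0 < N"
  shows "dcy_f N a =
      (var_x N \<ominus>\<^bsub>LR N\<^esub> \<one>\<^bsub>LR N\<^esub>) \<otimes>\<^bsub>LR N\<^esub> (var_x N \<ominus>\<^bsub>LR N\<^esub> scalar N a) \<and>
    dcy_g N a =
      (var_y N \<ominus>\<^bsub>LR N\<^esub> \<one>\<^bsub>LR N\<^esub>) \<otimes>\<^bsub>LR N\<^esub> (var_y N \<ominus>\<^bsub>LR N\<^esub> scalar N a) \<and>
    period_x N (dcy_f N a) (dcy_g N a) = dcy_period N a \<and>
    period_y N (dcy_f N a) (dcy_g N a) = dcy_period N a \<and>
    mobility_group N (dcy_f N a) (dcy_g N a) =
      generate (translation_group N)
        {var_x N [^]\<^bsub>LR N\<^esub> dcy_period N a, var_y N [^]\<^bsub>LR N\<^esub> dcy_period N a} \<and>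
    {(i, j). monom_xy N i j \<in> mobility_group N (dcy_f N a) (dcy_g N a)} =
      {i. int (dcy_period N a) dvd i} \<times> {j. int (dcy_period N a) dvd j} \<and>
    (1 < N \<longrightarrow>
      (translation_group N)\<lparr>carrier := mobility_group N (dcy_f N a) (dcy_g N a)\<rparr>
        \<cong> multiples_group (dcy_period N a) \<times>\<times> multiples_group (dcy_period N a))"
proof (intro conjI impI)
  show "dcy_f N a =
      (var_x N \<ominus>\<^bsub>LR N\<^esub> \<one>\<^bsub>LR N\<^esub>) \<otimes>\<^bsub>LR N\<^esub> (var_x N \<ominus>\<^bsub>LR N\<^esub> scalar N a)"
    unfolding dcy_f_def by (rule dcy_poly_factor)
  show "dcy_g N a =
      (var_y N \<ominus>\<^bsub>LR N\<^esub> \<one>\<^bsub>LR N\<^esub>) \<otimes>\<^bsub>LR N\<^esub> (var_y N \<ominus>\<^bsub>LR N\<^esub> scalar N a)"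
    unfolding dcy_g_def by (rule dcy_poly_factor)
  show "{(i, j). monom_xy N i j \<in> mobility_group N (dcy_f N a) (dcy_g N a)} =
      {i. int (dcy_period N a) dvd i} \<times> {j. int (dcy_period N a) dvd j}"
    by (auto simp: monom_xy_mem_mobility_group_iff[OF assms])
qed (fact period_x_dcy[OF assms] period_y_dcy[OF assms] mobility_group_dcy_eq_generate[OF assms]
    | rule mobility_group_dcy_iso, assumption)+

end
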